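(* The family of irreducible Artin groups and the family of Artin groups with connected defining graphs are uniformly large. On the other hand, the family of Artin groups of type FC is uniformly small. In particular, the family of right-angled Artin groups (RAAGs) and the family of triangle-free Artin groups are also uniformly small.
   Context: A defining graph $\Gamma$ is a finite simplicial graph with vertex set $V(\Gamma)$ and edge set $E(\Gamma)$, each edge $e_{ab}$ carrying a coefficient $m_{ab}\in\{2,3,\dots\}$; if $a\neq b$ are not joined by an edge, set $m_{ab}:=\infty$. The Artin group is $A_\Gamma=\langle V(\Gamma)\mid \underbrace{aba\cdots}_{m_{ab}}=\underbrace{bab\cdots}_{m_{ab}},\ e_{ab}\in E(\Gamma)\rangle$, and $W_\Gamma$ is the associated Coxeter group (add the relations $a^2=1$, $a\in V(\Gamma)$). For $N\ge 1$, $M\ge 2$, $\mathcal G^{N,M}$ is the finite set of all defining graphs on a fixed set of $N$ vertices with coefficients in $\{\infty,2,3,\dots,M\}$ (so $\#\mathcal G^{N,M}=M^{N(N-1)/2}$), with the uniform probability. For a class $\mathcal F$ of defining graphs with corresponding class $A_{\mathcal F}$ of Artin groups, and $f:\mathbf N\to\mathbf N$ non-decreasing and divergent ($f(N)\to\infty$), set $\mathbb P_f[A_\Gamma\in A_{\mathcal F}]:=\lim_{N\to\infty}\frac{\#(\mathcal F\cap\mathcal G^{N,f(N)})}{\#\mathcal G^{N,f(N)}}$, when the limit exists. (Membership of $A_\Gamma$ in $A_{\mathcal F}$ is thus read off the graph: $\Gamma\in\mathcal F$.) The family $A_{\mathcal F}$ is uniformly large (resp. uniformly small) if $\mathbb P_f[A_\Gamma\in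 A_{\mathcal F}]=1$ (resp. $=0$) for every non-decreasing divergent $f:\mathbf N\to\mathbf N$. $\Gamma$ is reducible if $V(\Gamma)$ is a disjoint union of two non-empty sets $V_1,V_2$ with $m_{ab}=2$ for all $a\in V_1$, $b\in V_2$; otherwise it (and $A_\Gamma$) is irreducible. $\Gamma$ is connected if it is connected as a graph (edges being the pairs with $m_{ab}<\infty$). $A_\Gamma$ is spherical if $W_\Gamma$ is finite. $A_\Gamma$ is of type FC if for every complete full subgraph $\Gamma'\subseteq\Gamma$ (all pairs of vertices joined by an edge) the group $A_{\Gamma'}$ is spherical. $A_\Gamma$ is a RAAG if all $m_{ab}\in\{2,\infty\}$. $A_\Gamma$ is triangle-free if $\Gamma$ contains no 3-cycle. *)

theory Defs
  imports Complex_Main "HOL-Library.Extended_Nat" "HOL-Algebra.Group"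
begin

section \<open>Group presentations\<close>

text \<open>A letter \<open>(a, True)\<close> stands for the generator \<open>a\<close>, and \<open>(a, False)\<close> for its
  formal inverse. A presentation is given by a set \<open>S\<close> of generators and a set \<open>R\<close> of
  relations \<open>u = v\<close> between words.\<close>

type_synonym 'a word = "('a \<times> bool) list"

definition words_over :: "'a set \<Rightarrow> 'a word set" where
  "words_over S = lists (S \<times> UNIV)"

inductive_set pres_rel :: "'a set \<Rightarrow> ('a word \<times> 'a word) set \<Rightarrow> ('a word \<times> 'a word) set"
  for S :: "'a set" and R :: "('a word \<times> 'a word) set" where
  refl: "w \<in> words_over S \<Longrightarrow> (w, w) \<in> pres_rel S R"
| sym: "(u, v) \<in> pres_rel S R \<Longrightarrow> (v, u) \<in> pres_rel S R"
| trans: "(u, v) \<in> pres_rel S R \<Longrightarrow> (v, w) \<in> pres_rel S R \<Longrightarrow> (u, w) \<in> pres_rel S R"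
| cancel: "x \<in> words_over S \<Longrightarrow> y \<in> words_over S \<Longrightarrow> a \<in> S
    \<Longrightarrow> (x @ [(a, e), (a, \<not> e)] @ y, x @ y) \<in> pres_rel S R"
| relation: "x \<in> words_over S \<Longrightarrow> y \<in> words_over S \<Longrightarrow> u \<in> words_over S \<Longrightarrow> v \<in> words_over S
    \<Longrightarrow> (u, v) \<in> R \<Longrightarrow> (x @ u @ y, x @ v @ y) \<in> pres_rel S R"

definition presented_group :: "'a set \<Rightarrow> ('a word \<times> 'a word) set \<Rightarrow> 'a word set monoid" where
  "presented_group S R =
     \<lparr>carrier = words_over S // pres_rel S R,
      mult = (\<lambda>X Y. \<Union>x\<in>X. \<Union>y\<in>Y. pres_rel S R `` {x @ y}),
      one = pres_rel S R `` {[]}\<rparr>"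

lemma words_over_simps [simp]:
  "[] \<in> words_over S"
  "x @ y \<in> words_over S \<longleftrightarrow> x \<in> words_over S \<and> y \<in> words_over S"
  "p # x \<in> words_over S \<longleftrightarrow> fst p \<in> S \<and> x \<in> words_over S"
  by (auto simp: words_over_def mem_Times_iff)

lemma pres_rel_words:
  "(u, v) \<in> pres_rel S R \<Longrightarrow> u \<in> words_over S \<and> v \<in> words_over S"
  by (induction rule: pres_rel.induct) auto

lemma equiv_pres_rel: "equiv (words_over S) (pres_rel S R)"
proof (rule equivI)
  show "pres_rel S R \<subseteq> words_over S \<times> words_over S"
    using pres_rel_words by fast
  show "refl_on (words_over S) (pres_rel S R)"
    by (auto simp: refl_on_def intro: pres_rel.refl)
  show "Relation.sym (pres_rel S R)"
    by (rule symI) (rule pres_rel.sym)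
  show "Relation.trans (pres_rel S R)"
    by (rule transI) (rule pres_rel.trans)
qed

lemma pres_rel_context:
  assumes "(u, v) \<in> pres_rel S R" "p \<in> words_over S" "q \<in> words_over S"
  shows "(p @ u @ q, p @ v @ q) \<in> pres_rel S R"
  using assms(1)
proof (induction rule: pres_rel.induct)
  case (cancel x y a e)
  then show ?case
    using assms pres_rel.cancel[of "p @ x" S "y @ q" a e R] by simp
next
  case (relation x y u v)
  then show ?case
    using assms pres_rel.relation[of "p @ x" S "y @ q" u v R] by simp
next
  case (refl w)
  then show ?case
    using assms by (intro pres_rel.refl) simp
next
  case (sym u v)
  from sym.IH show ?case by (rule pres_rel.sym)
next
  case (trans u v w)
  from trans.IH show ?case by (rule pres_rel.trans)
qed

lemma pres_rel_append:
  assumes "(u, u') \<in> pres_rel S R" "(v, v') \<in> pres_rel S R"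
  shows "(u @ v, u' @ v') \<in> pres_rel S R"
proof (rule pres_rel.trans)
  show "(u @ v, u' @ v) \<in> pres_rel S R"
    using pres_rel_context[OF assms(1), of "[]" v] pres_rel_words[OF assms(2)] by simp
  show "(u' @ v, u' @ v') \<in> pres_rel S R"
    using pres_rel_context[OF assms(2), of u' "[]"] pres_rel_words[OF assms(1)] by simp
qed

lemma mult_presented_group:
  assumes "u \<in> words_over S" "v \<in> words_over S"
  shows "pres_rel S R `` {u} \<otimes>\<^bsub>presented_group S R\<^esub> pres_rel S R `` {v}
    = pres_rel S R `` {u @ v}"
proof -
  have "pres_rel S R `` {x @ y} = pres_rel S R `` {u @ v}"
    if "(u, x) \<in> pres_rel S R" "(v, y) \<in> pres_rel S R" for x y
    using equiv_class_eq[OF equiv_pres_rel pres_rel_append[OF that]] by simp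
  then have "(\<Union>x\<in>pres_rel S R `` {u}. \<Union>y\<in>pres_rel S R `` {v}. pres_rel S R `` {x @ y})
    = (\<Union>x\<in>pres_rel S R `` {u}. \<Union>y\<in>pres_rel S R `` {v}. pres_rel S R `` {u @ v})"
    by (intro SUP_cong refl) simp_all
  also have "\<dots> = pres_rel S R `` {u @ v}"
    using pres_rel.refl[OF assms(1)] pres_rel.refl[OF assms(2)] by blast
  finally show ?thesis
    by (simp add: presented_group_def)
qed

lemma inverse_word:
  assumes "w \<in> words_over S"
  shows "\<exists>w'\<in>words_over S. (w' @ w, []) \<in> pres_rel S R"
  using assms
proof (induction w)
  case Nil
  have "([] @ [], []) \<in> pres_rel S R" by (simp add: pres_rel.refl)
  then show ?case using words_over_simps(1) by blast
next
  case (Cons p w)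
  obtain a e where p: "p = (a, e)" by (cases p)
  from Cons obtain w' where w': "w' \<in> words_over S" "(w' @ w, []) \<in> pres_rel S R" by auto
  have "(w' @ [(a, \<not> e), (a, \<not> \<not> e)] @ w, w' @ w) \<in> pres_rel S R"
    using Cons.prems w' p by (intro pres_rel.cancel) auto
  then have "((w' @ [(a, \<not> e)]) @ p # w, []) \<in> pres_rel S R"
    using pres_rel.trans[OF _ w'(2)] p by simp
  moreover have "w' @ [(a, \<not> e)] \<in> words_over S"
    using Cons.prems w' p by auto
  ultimately show ?case by blast
qed

lemma group_presented_group: "group (presented_group S R)"
proof -
  let ?G = "presented_group S R" and ?c = "\<lambda>w. pres_rel S R `` {w}"
  have carr: "carrier ?G = ?c ` words_over S"
    by (auto simp: presented_group_def quotient_def)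
  have one: "\<one>\<^bsub>?G\<^esub> = ?c []" by (simp add: presented_group_def)
  show ?thesis
  proof (rule groupI)
    fix x assume "x \<in> carrier ?G"
    then obtain w where w: "w \<in> words_over S" "x = ?c w" using carr by auto
    from inverse_word[OF w(1)] obtain w' where
      w': "w' \<in> words_over S" "(w' @ w, []) \<in> pres_rel S R" by blast
    have "?c w' \<otimes>\<^bsub>?G\<^esub> x = \<one>\<^bsub>?G\<^esub>"
      using w w' mult_presented_group[of w' S w R] equiv_class_eq[OF equiv_pres_rel w'(2)] one
      by simp
    then show "\<exists>y\<in>carrier ?G. y \<otimes>\<^bsub>?G\<^esub> x = \<one>\<^bsub>?G\<^esub>"
      using w' carr by blast
  qed (auto simp: carr one mult_presented_group)
qed


section \<open>Defining graphs\<close>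

record 'a labelled_graph =
  verts :: "'a set"
  edges :: "'a set set"
  label :: "'a set \<Rightarrow> nat"

text \<open>The function \<open>label\<close> is required to be \<open>undefined\<close> outside the edge set, so that two
  defining graphs are equal iff they have the same vertices, edges and coefficients.\<close>

definition defining_graph :: "'a labelled_graph \<Rightarrow> bool" where
  "defining_graph \<Gamma> \<longleftrightarrow>
     finite (verts \<Gamma>) \<and>
     (\<forall>e\<in>edges \<Gamma>. e \<subseteq> verts \<Gamma> \<and> card e = 2) \<and>
     label \<Gamma> \<in> edges \<Gamma> \<rightarrow>\<^sub>E {2..}"

definition coeff :: "'a labelled_graph \<Rightarrow> 'a \<Rightarrow> 'a \<Rightarrow> enat" where
  "coeff \<Gamma> a b = (if {a, b} \<in> edges \<Gamma> then enat (label \<Gamma> {a, b}) else \<infinity>)"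

definition full_subgraph :: "'a labelled_graph \<Rightarrow> 'a set \<Rightarrow> 'a labelled_graph" where
  "full_subgraph \<Gamma> U =
     (let E = {e \<in> edges \<Gamma>. e \<subseteq> U} in
      \<lparr>verts = U, edges = E, label = restrict (label \<Gamma>) E\<rparr>)"

definition complete_graph :: "'a labelled_graph \<Rightarrow> bool" where
  "complete_graph \<Gamma> \<longleftrightarrow> (\<forall>a\<in>verts \<Gamma>. \<forall>b\<in>verts \<Gamma>. a \<noteq> b \<longrightarrow> {a, b} \<in> edges \<Gamma>)"

definition connected_graph :: "'a labelled_graph \<Rightarrow> bool" where
  "connected_graph \<Gamma> \<longleftrightarrow>
     (\<forall>a\<in>verts \<Gamma>. \<forall>b\<in>verts \<Gamma>. (a, b) \<in> {(x, y). {x, y} \<in> edges \<Gamma>}\<^sup>*)"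

definition reducible_graph :: "'a labelled_graph \<Rightarrow> bool" where
  "reducible_graph \<Gamma> \<longleftrightarrow>
     (\<exists>V\<^sub>1 V\<^sub>2. V\<^sub>1 \<noteq> {} \<and> V\<^sub>2 \<noteq> {} \<and> V\<^sub>1 \<inter> V\<^sub>2 = {} \<and> verts \<Gamma> = V\<^sub>1 \<union> V\<^sub>2 \<and>
        (\<forall>a\<in>V\<^sub>1. \<forall>b\<in>V\<^sub>2. coeff \<Gamma> a b = 2))"

definition irreducible_graph :: "'a labelled_graph \<Rightarrow> bool" where
  "irreducible_graph \<Gamma> \<longleftrightarrow> \<not> reducible_graph \<Gamma>"

definition triangle_free_graph :: "'a labelled_graph \<Rightarrow> bool" where
  "triangle_free_graph \<Gamma> \<longleftrightarrow>
     \<not> (\<exists>a b c. a \<noteq> b \<and> b \<noteq> c \<and> a \<noteq> c \<and>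
          {a, b} \<in> edges \<Gamma> \<and> {b, c} \<in> edges \<Gamma> \<and> {a, c} \<in> edges \<Gamma>)"


section \<open>Artin groups and Coxeter groups\<close>

fun alternating :: "nat \<Rightarrow> 'a \<Rightarrow> 'a \<Rightarrow> 'a word" where
  "alternating 0 a b = []"
| "alternating (Suc n) a b = (a, True) # alternating n b a"

definition artin_relations :: "'a labelled_graph \<Rightarrow> ('a word \<times> 'a word) set" where
  "artin_relations \<Gamma> =
     {(alternating (label \<Gamma> {a, b}) a b, alternating (label \<Gamma> {a, b}) b a) | a b.
        {a, b} \<in> edges \<Gamma>}"

definition coxeter_relations :: "'a labelled_graph \<Rightarrow> ('a word \<times> 'a word) set" where
  "coxeter_relations \<Gamma> =
     artin_relations \<Gamma> \<union> {([(a, True), (a, True)], []) | a. a \<in> verts \<Gamma>}"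

definition artin_group :: "'a labelled_graph \<Rightarrow> 'a word set monoid" where
  "artin_group \<Gamma> = presented_group (verts \<Gamma>) (artin_relations \<Gamma>)"

definition coxeter_group :: "'a labelled_graph \<Rightarrow> 'a word set monoid" where
  "coxeter_group \<Gamma> = presented_group (verts \<Gamma>) (coxeter_relations \<Gamma>)"

text \<open>The following are properties of the Artin group of \<open>\<Gamma>\<close>, but all of them are, by
  definition, read off the graph \<open>\<Gamma>\<close>. So classes of Artin groups are represented by the
  corresponding classes of defining graphs.\<close>

definition spherical :: "'a labelled_graph \<Rightarrow> bool" where
  "spherical \<Gamma> \<longleftrightarrow> finite (carrier (coxeter_group \<Gamma>))"

definition type_FC :: "'a labelled_graph \<Rightarrow> bool" where
  "type_FC \<Gamma> \<longleftrightarrow>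
     (\<forall>U. U \<subseteq> verts \<Gamma> \<and> complete_graph (full_subgraph \<Gamma> U) \<longrightarrow> spherical (full_subgraph \<Gamma> U))"

definition raag :: "'a labelled_graph \<Rightarrow> bool" where
  "raag \<Gamma> \<longleftrightarrow> (\<forall>a\<in>verts \<Gamma>. \<forall>b\<in>verts \<Gamma>. a \<noteq> b \<longrightarrow> coeff \<Gamma> a b \<in> {2, \<infinity>})"


section \<open>Random defining graphs\<close>

definition graphs_upto :: "nat \<Rightarrow> nat \<Rightarrow> nat labelled_graph set" where
  "graphs_upto N M =
     {\<Gamma>. defining_graph \<Gamma> \<and> verts \<Gamma> = {..<N} \<and>
         (\<forall>a\<in>verts \<Gamma>. \<forall>b\<in>verts \<Gamma>. a \<noteq> b \<longrightarrow> coeff \<Gamma> a b \<in> {\<infinity>} \<union> enat ` {2..M})}"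

text \<open>\<open>has_asymptotic_prob f F p\<close> states that the limit defining the probability that a random
  graph lies in \<open>F\<close> exists and equals \<open>p\<close>.\<close>

definition has_asymptotic_prob ::
    "(nat \<Rightarrow> nat) \<Rightarrow> nat labelled_graph set \<Rightarrow> real \<Rightarrow> bool" where
  "has_asymptotic_prob f F p \<longleftrightarrow>
     (\<lambda>N. real (card (F \<inter> graphs_upto N (f N))) / real (card (graphs_upto N (f N))))
       \<longlonglongrightarrow> p"

definition uniformly_large :: "nat labelled_graph set \<Rightarrow> bool" where
  "uniformly_large F \<longleftrightarrow>
     (\<forall>f. mono f \<and> filterlim f at_top sequentially \<longrightarrow> has_asymptotic_prob f F 1)"

definition uniformly_small :: "nat labelled_graph set \<Rightarrow> bool" where
  "uniformly_small F \<longleftrightarrow>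
     (\<forall>f. mono f \<and> filterlim f at_top sequentially \<longrightarrow> has_asymptotic_prob f F 0)"

end

theory Submission
  imports Defs
begin

text \<open>A random graph in \<open>graphs_upto N M\<close> amounts to an independent uniform choice, for each pair of
  vertices, of one of the \<open>M\<close> values \<open>\<infinity>, 2, \<dots>, M\<close> (lemma \<open>bij_betw_edge_coeff\<close>). So the coefficients of
  the pairs in a set \<open>J\<close> all lie in \<open>B\<close> with probability \<open>(|B| / M)\<^sup>|\<^sup>J\<^sup>|\<close> (lemma
  \<open>graph_prob_edges\<close>), and each claim follows from this and a union bound.

  A graph that is reducible, or is not connected, has a non-trivial cut all of whose crossing pairs
  have the same coefficient: \<open>2\<close> in the first case and \<open>\<infinity>\<close> in the second. At least
  \<open>N - 1\<close> pairs cross any cut, and there are fewer than \<open>2\<^sup>N\<close> cuts, so such a cut exists with probability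
  at most \<open>2\<^sup>N / M\<^sup>N\<^sup>-\<^sup>1\<close>. As \<open>M = f N\<close> is eventually at least 4, this tends to 0, however
  slowly \<open>f\<close> grows (lemma \<open>uniformly_large_if_cut\<close>).

  For the remaining three families it is enough to look at the triangle on the vertices \<open>0, 1, 2\<close>.
  The probability that one of its three coefficients is \<open>2\<close> or \<open>\<infinity>\<close> is at most \<open>6 / M\<close>, which
  tends to 0 (lemma \<open>uniformly_small_if_triangle\<close>). If none of them is, then \<open>\<Gamma>\<close> contains a
  triangle and is not a RAAG. Nor is it of type FC, because the Coxeter group of a triangle with all
  labels at least 3 is infinite (lemma \<open>not_spherical_triangle\<close>).

  That last fact is shown with the reflection representation on the functions \<open>v\<close> from vertices to reals,
  in which the generator \<open>a\<close> replaces \<open>v a\<close> by \<open>(\<Sum>x. 2 cos (\<pi> / m\<^sub>a\<^sub>x) v x) - v a\<close>. On a triangle with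
  labels at least 3, all the factors \<open>2 cos (\<pi> / m)\<close> are at least 1, so that reflecting the smallest of three
  non-negative distinct coordinates makes it the largest. Applying \<open>a, b, c, a, b, c, \<dots>\<close> cyclically
  therefore makes the coordinates grow for ever, and the orbit is infinite.\<close>

section \<open>Actions of presented groups\<close>

text \<open>Letters act on states from the first letter of a word to the last. If inverse letters act as inverse
  maps and the two sides of each relation act alike, the action of a word depends on its class only.\<close>

lemma fold_eq_if_pres_rel:
  assumes inv: "\<And>a e s. T (a, \<not> e) (T (a, e) s) = s"
    and rel: "\<And>u v. (u, v) \<in> R \<Longrightarrow> fold T u = fold T v"
    and "(u, v) \<in> pres_rel S R"
  shows "fold T u = fold T v"
  using assms(3)
proof (induction rule: pres_rel.induct)
  case (cancel x y a e)
  have "fold T [(a, e), (a, \<not> e)] = id"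
    by (simp add: fun_eq_iff inv)
  then show ?case by (simp only: fold_append o_id id_o o_assoc[symmetric])
next
  case (relation x y u v)
  then show ?case using rel[of u v] by simp
qed auto

text \<open>The orbit of \<open>s\<close> is an image of the group, as \<open>fold T w s\<close> is constant on the class of \<open>w\<close>.\<close>

lemma infinite_presented_group:
  assumes inv: "\<And>a e s. T (a, \<not> e) (T (a, e) s) = s"
    and rel: "\<And>u v. (u, v) \<in> R \<Longrightarrow> fold T u = fold T v"
    and orbit: "infinite ((\<lambda>w. fold T w s) ` words_over S)"
  shows "infinite (carrier (presented_group S R))"
proof
  assume "finite (carrier (presented_group S R))"
  then have fin: "finite (words_over S // pres_rel S R)"
    by (simp add: presented_group_def)
  let ?h = "\<lambda>X. the_elem ((\<lambda>w. fold T w s) ` X)"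
  have "fold T w s = ?h (pres_rel S R `` {w})" if w: "w \<in> words_over S" for w
  proof -
    have "fold T u s = fold T w s" if "u \<in> pres_rel S R `` {w}" for u
      using fold_eq_if_pres_rel[of T R w u S, OF inv rel] that by simp
    moreover have "w \<in> pres_rel S R `` {w}"
      using w by (simp add: pres_rel.refl)
    ultimately have "(\<lambda>w. fold T w s) ` (pres_rel S R `` {w}) = {fold T w s}"
      by blast
    then show ?thesis by simp
  qed
  then have "(\<lambda>w. fold T w s) ` words_over S \<subseteq> ?h ` (words_over S // pres_rel S R)"
    by (auto intro!: image_eqI quotientI)
  with fin orbit show False
    using finite_surj by blast
qed


section \<open>The reflection representation of a Coxeter group\<close>

text \<open>This is \<open>- 2 B(e\<^sub>a, e\<^sub>b)\<close> for the canonical bilinear form \<open>B\<close> of the Coxeter group; pairs without an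
  edge get the limit of \<open>2 cos (\<pi> / m)\<close> as \<open>m\<close> tends to \<open>\<infinity>\<close>.\<close>

definition weight :: "'a labelled_graph \<Rightarrow> 'a \<Rightarrow> 'a \<Rightarrow> real" where
  "weight \<Gamma> a b = (if {a, b} \<in> edges \<Gamma> then 2 * cos (pi / real (label \<Gamma> {a, b})) else 2)"

text \<open>The map \<open>v \<longmapsto> v - 2 B(e\<^sub>a, v) e\<^sub>a\<close>, in coordinates with respect to the basis of simple roots.\<close>

definition reflection :: "'a labelled_graph \<Rightarrow> 'a \<Rightarrow> ('a \<Rightarrow> real) \<Rightarrow> 'a \<Rightarrow> real" where
  "reflection \<Gamma> a v = v(a := (\<Sum>x\<in>verts \<Gamma> - {a}. weight \<Gamma> a x * v x) - v a)"

lemma reflection_involution [simp]: "reflection \<Gamma> a (reflection \<Gamma> a v) = v"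
proof -
  have "(\<Sum>x\<in>verts \<Gamma> - {a}. weight \<Gamma> a x * (v(a := y)) x)
      = (\<Sum>x\<in>verts \<Gamma> - {a}. weight \<Gamma> a x * v x)" for y
    by (rule sum.cong) auto
  then show ?thesis by (simp add: reflection_def fun_eq_iff)
qed

text \<open>The solution \<open>u\<close> of the recurrence \<open>u (t + 1) = 2 cos \<theta> u t - u (t - 1)\<close> with \<open>u 0 = x\<close> and
  \<open>u 1 = y\<close>.\<close>

definition dihedral_orbit :: "real \<Rightarrow> real \<Rightarrow> real \<Rightarrow> real \<Rightarrow> real" where
  "dihedral_orbit \<theta> x y t = (y * sin (t * \<theta>) - x * sin ((t - 1) * \<theta>)) / sin \<theta>"

text \<open>The solution with the initial values \<open>u 1\<close> and \<open>u 2\<close> is the shifted solution.\<close>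

lemma dihedral_orbit_shift:
  "dihedral_orbit \<theta> y (2 * cos \<theta> * y - x) t = dihedral_orbit \<theta> x y (t + 1)"
proof -
  have "sin ((t + 1) * \<theta>) + sin ((t - 1) * \<theta>) = 2 * cos \<theta> * sin (t * \<theta>)"
    by (simp add: algebra_simps sin_add sin_diff)
  then have "y * sin (t * \<theta> + \<theta>) = (2 * cos \<theta> * y) * sin (t * \<theta>) - y * sin ((t - 1) * \<theta>)"
    by (simp add: distrib_right) algebra
  then show ?thesis
    by (simp add: dihedral_orbit_def distrib_right left_diff_distrib)
qed

text \<open>Two involutions that act alternately, and change only the coordinates \<open>a\<close> and \<open>b\<close>, produce a single
  sequence: each step replaces the older of its last two terms by the next term. Measured from a common fixed
  point \<open>(A, B)\<close>, the sequence satisfies the recurrence that \<open>dihedral_orbit\<close> solves. The parity of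
  \<open>n\<close> decides which coordinate holds the newer term.\<close>

lemma fold_alternating:
  fixes v :: "'a \<Rightarrow> real"
  assumes "sin \<theta> \<noteq> 0" "a \<noteq> b"
    and "\<And>x y. T (a, True) (v(a := A + x, b := B + y)) = v(a := A + (2 * cos \<theta> * y - x), b := B + y)"
    and "\<And>x y. T (b, True) (v(a := A + x, b := B + y)) = v(a := A + x, b := B + (2 * cos \<theta> * x - y))"
  shows "fold T (alternating n a b) (v(a := A + x, b := B + y)) =
     (let p = dihedral_orbit \<theta> x y (real n); q = dihedral_orbit \<theta> x y (real n + 1) in
      if even n then v(a := A + p, b := B + q) else v(a := A + q, b := B + p))"
  using assms
proof (induction n arbitrary: a b A B x y)
  case 0
  have "dihedral_orbit \<theta> x y 0 = x" "dihedral_orbit \<theta> x y 1 = y"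
    using \<open>sin \<theta> \<noteq> 0\<close> by (simp_all add: dihedral_orbit_def)
  then show ?case by (simp add: Let_def del: fun_upd_apply)
next
  case (Suc n)
  let ?z = "2 * cos \<theta> * y - x"
  have twist: "v(b := t, a := s) = v(a := s, b := t)" for s t
    using Suc.prems(2) by (rule fun_upd_twist[OF not_sym])
  have "fold T (alternating (Suc n) a b) (v(a := A + x, b := B + y))
      = fold T (alternating n b a) (v(a := A + ?z, b := B + y))"
    by (simp add: Suc.prems(3) del: fun_upd_apply)
  also have "\<dots> = fold T (alternating n b a) (v(b := B + y, a := A + ?z))"
    by (simp only: twist)
  also have "\<dots> = (let p = dihedral_orbit \<theta> y ?z (real n); q = dihedral_orbit \<theta> y ?z (real n + 1) in
      if even n then v(b := B + p, a := A + q) else v(b := B + q, a := A + p))"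
    by (intro Suc.IH) (use Suc.prems in \<open>simp_all add: twist del: fun_upd_apply\<close>)
  finally show ?case
    by (simp add: dihedral_orbit_shift Let_def add.commute twist del: fun_upd_apply)
qed

text \<open>The coordinates other than \<open>a\<close> and \<open>b\<close> stay constant, so both reflections act on the
  \<open>(a, b)\<close>-plane as affine maps. These have a common fixed point, as the linear system for it has
  determinant \<open>4 (sin \<theta>)\<^sup>2\<close> with \<open>\<theta> = \<pi> / m\<close>. By \<open>fold_alternating\<close>, \<open>m\<close> steps end in the terms
  \<open>u m\<close> and \<open>u (m + 1)\<close>, which are \<open>- u 0\<close> and \<open>- u 1\<close> because \<open>m \<theta> = \<pi>\<close>. Starting with \<open>b\<close>
  exchanges \<open>u 0\<close> and \<open>u 1\<close> together with the roles of the coordinates, so it leads to the same vector.\<close>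

lemma reflection_fold_braid:
  assumes \<Gamma>: "defining_graph \<Gamma>" and e: "{a, b} \<in> edges \<Gamma>"
  defines "m \<equiv> label \<Gamma> {a, b}"
  shows "fold (\<lambda>(a, e). reflection \<Gamma> a) (alternating m a b)
    = fold (\<lambda>(a, e). reflection \<Gamma> a) (alternating m b a)"
proof
  fix v :: "'a \<Rightarrow> real"
  let ?T = "\<lambda>(a, e :: bool). reflection \<Gamma> a"
  have fin: "finite (verts \<Gamma>)" and "card {a, b} = 2" and V: "a \<in> verts \<Gamma>" "b \<in> verts \<Gamma>"
    and m: "m \<ge> 2"
    using \<Gamma> e unfolding defining_graph_def m_def by (auto simp: PiE_iff)
  then have ab: "a \<noteq> b" by auto
  define \<theta> where "\<theta> = pi / real m"
  have mt: "real m * \<theta> = pi" using m by (simp add: \<theta>_def)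
  have \<theta>: "0 < \<theta>" "\<theta> < pi"
    using m by (simp_all add: \<theta>_def field_simps)
  then have sin: "sin \<theta> > 0" by (rule sin_gt_zero)
  let ?k = "2 * cos \<theta>"
  have w: "weight \<Gamma> a b = ?k" "weight \<Gamma> b a = ?k"
    using e by (simp_all add: weight_def m_def \<theta>_def insert_commute)
  \<comment> \<open>The constant contributions of the other coordinates to the two reflections.\<close>
  define p where "p = (\<Sum>x\<in>verts \<Gamma> - {a, b}. weight \<Gamma> a x * v x)"
  define q where "q = (\<Sum>x\<in>verts \<Gamma> - {a, b}. weight \<Gamma> b x * v x)"
  define D where "D = 4 - ?k^2"
  have "D = 4 * (sin \<theta>)^2"
    by (simp add: D_def sin_squared_eq power_mult_distrib)
  with sin have D: "D \<noteq> 0" by simp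
  \<comment> \<open>The common fixed point: the solution of \<open>2 A - ?k B = p\<close> and \<open>2 B - ?k A = q\<close>.\<close>
  define A where "A = (2 * p + ?k * q) / D"
  define B where "B = (2 * q + ?k * p) / D"
  have "D * (2 * A - ?k * B) = D * p" "D * (2 * B - ?k * A) = D * q"
    using D by (simp_all add: A_def B_def right_diff_distrib)
      (simp_all add: D_def algebra_simps power2_eq_square)
  then have A: "p = 2 * A - ?k * B" and B: "q = 2 * B - ?k * A"
    using D by simp_all
  have split: "(\<Sum>x\<in>verts \<Gamma> - {c}. weight \<Gamma> c x * (v(a := s, b := t)) x)
      = weight \<Gamma> c d * (v(a := s, b := t)) d + (\<Sum>x\<in>verts \<Gamma> - {a, b}. weight \<Gamma> c x * v x)"
    if "{c, d} = {a, b}" for c d s t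
  proof -
    let ?f = "\<lambda>x. weight \<Gamma> c x * (v(a := s, b := t)) x"
    have "d \<in> verts \<Gamma> - {c}"
      using that V ab by (auto simp: doubleton_eq_iff)
    then have "sum ?f (verts \<Gamma> - {c}) = ?f d + sum ?f (verts \<Gamma> - {c} - {d})"
      using fin by (intro sum.remove) simp_all
    also have "verts \<Gamma> - {c} - {d} = verts \<Gamma> - {a, b}"
      using that by blast
    also have "sum ?f (verts \<Gamma> - {a, b}) = (\<Sum>x\<in>verts \<Gamma> - {a, b}. weight \<Gamma> c x * v x)"
      by (rule sum.cong) simp_all
    finally show ?thesis .
  qed
  have Sa: "(\<Sum>x\<in>verts \<Gamma> - {a}. weight \<Gamma> a x * (v(a := s, b := t)) x) = ?k * t + p" for s t
    unfolding split[OF HOL.refl] w p_def by simp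
  have Sb: "(\<Sum>x\<in>verts \<Gamma> - {b}. weight \<Gamma> b x * (v(a := s, b := t)) x) = ?k * s + q" for s t
    unfolding split[OF insert_commute] w q_def using ab by simp
  have Ta: "?T (a, True) (v(a := A + x, b := B + y)) = v(a := A + (?k * y - x), b := B + y)" for x y
    unfolding prod.case reflection_def Sa using ab by (simp add: A fun_eq_iff algebra_simps)
  have Tb: "?T (b, True) (v(a := A + x, b := B + y)) = v(a := A + x, b := B + (?k * x - y))" for x y
    unfolding prod.case reflection_def Sb using ab by (simp add: B fun_eq_iff algebra_simps)
  have "sin ((real m - 1) * \<theta>) = sin \<theta>" "sin ((real m + 1) * \<theta>) = - sin \<theta>"
    by (simp_all add: left_diff_distrib distrib_right mt)
  then have orb: "dihedral_orbit \<theta> x y (real m) = - x" "dihedral_orbit \<theta> x y (real m + 1) = - y" for x y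
    using sin by (simp_all add: dihedral_orbit_def mt)
  define x y where "x = v a - A" and "y = v b - B"
  have v: "v(a := A + x, b := B + y) = v" "v(b := B + y, a := A + x) = v"
    by (simp_all add: x_def y_def)
  have twist: "v(b := t, a := s) = v(a := s, b := t)" for s t
    using ab by (rule fun_upd_twist[OF not_sym])
  have "fold ?T (alternating m a b) v =
      (if even m then v(a := A - x, b := B - y) else v(a := A - y, b := B - x))"
    using fold_alternating[of \<theta> a b ?T v A B m x y, OF _ ab Ta Tb] sin
    unfolding v orb by simp
  moreover have "fold ?T (alternating m b a) v =
      (if even m then v(b := B - y, a := A - x) else v(b := B - x, a := A - y))"
    using fold_alternating[of \<theta> b a ?T v B A m y x, OF _ ab[symmetric] Tb[folded twist] Ta[folded twist]] sin
    unfolding v orb by simp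
  ultimately show "fold ?T (alternating m a b) v = fold ?T (alternating m b a) v"
    by (simp only: twist)
qed

lemma not_spherical_if_infinite_orbit:
  assumes "defining_graph \<Gamma>"
    and "infinite ((\<lambda>w. fold (\<lambda>(a, e). reflection \<Gamma> a) w s) ` words_over (verts \<Gamma>))"
  shows "\<not> spherical \<Gamma>"
  unfolding spherical_def coxeter_group_def
proof (rule infinite_presented_group[OF _ _ assms(2)])
  fix u v assume "(u, v) \<in> coxeter_relations \<Gamma>"
  then show "fold (\<lambda>(a, e). reflection \<Gamma> a) u = fold (\<lambda>(a, e). reflection \<Gamma> a) v"
  proof (cases "(u, v) \<in> artin_relations \<Gamma>")
    case True
    then show ?thesis
      using reflection_fold_braid[OF assms(1)] unfolding artin_relations_def by blast
  next
    case False
    with \<open>(u, v) \<in> coxeter_relations \<Gamma>\<close> obtain a where "u = [(a, True), (a, True)]" "v = []"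
      by (auto simp: coxeter_relations_def)
    then show ?thesis
      by (simp add: fun_eq_iff del: fun_upd_apply)
  qed
qed simp

lemma two_cos_ge_1:
  assumes "m \<ge> 3"
  shows "2 * cos (pi / real m) \<ge> 1"
proof -
  have "cos (pi / 3) \<le> cos (pi / real m)"
    using assms by (intro cos_monotone_0_pi_le) (auto simp: field_simps)
  then show ?thesis by (simp add: cos_60)
qed

text \<open>The new coordinate is at least \<open>v b + v c - v a\<close>, which exceeds \<open>v c\<close>. So the hypotheses on the order of
  the coordinates hold again after the cyclic renaming \<open>a \<rightarrow> b \<rightarrow> c \<rightarrow> a\<close>, and the step can be repeated.\<close>

lemma reflection_grows:
  assumes V: "verts \<Gamma> = {a, b, c}" "a \<noteq> b" "b \<noteq> c" "a \<noteq> c"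
    and E: "{a, b} \<in> edges \<Gamma>" "{a, c} \<in> edges \<Gamma>"
    and m: "label \<Gamma> {a, b} \<ge> 3" "label \<Gamma> {a, c} \<ge> 3"
    and v: "0 \<le> v a" "v a < v b" "v b < v c"
    and v': "v' = reflection \<Gamma> a v"
  shows "0 \<le> v' b" "v' b < v' c" "v' c < v' a" "v' b = v b"
proof -
  have "verts \<Gamma> - {a} = {b, c}" using V by auto
  then have "v' a = weight \<Gamma> a b * v b + weight \<Gamma> a c * v c - v a"
    using V v' by (simp add: reflection_def)
  moreover have "weight \<Gamma> a b \<ge> 1" "weight \<Gamma> a c \<ge> 1"
    using E m two_cos_ge_1 by (simp_all add: weight_def)
  then have "weight \<Gamma> a b * v b \<ge> 1 * v b" "weight \<Gamma> a c * v c \<ge> 1 * v c"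
    using v by (intro mult_right_mono; simp)+
  ultimately have "v' a \<ge> v b + v c - v a" by simp
  moreover have "v' b = v b" "v' c = v c"
    using V v' by (simp_all add: reflection_def)
  ultimately show "0 \<le> v' b" "v' b < v' c" "v' c < v' a" "v' b = v b"
    using v by simp_all
qed

text \<open>The words \<open>(abc)\<^sup>n\<close> move a suitable starting vector to vectors with strictly increasing coordinate
  \<open>a\<close>, so they represent pairwise distinct elements of the Coxeter group.\<close>

lemma not_spherical_triangle:
  assumes \<Gamma>: "defining_graph \<Gamma>"
    and V: "verts \<Gamma> = {a, b, c}" "a \<noteq> b" "b \<noteq> c" "a \<noteq> c"
    and E: "{a, b} \<in> edges \<Gamma>" "{b, c} \<in> edges \<Gamma>" "{a, c} \<in> edges \<Gamma>"
    and m: "label \<Gamma> {a, b} \<ge> 3" "label \<Gamma> {b, c} \<ge> 3" "label \<Gamma> {a, c} \<ge> 3"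
  shows "\<not> spherical \<Gamma>"
proof -
  let ?T = "\<lambda>(a, e :: bool). reflection \<Gamma> a"
  let ?abc = "[(a, True), (b, True), (c, True)]"
  \<comment> \<open>Any starting vector with \<open>0 \<le> s a < s b < s c\<close> would do.\<close>
  define s :: "'a \<Rightarrow> real" where "s = (\<lambda>_. 0)(b := 1, c := 2)"
  define g where "g n = fold ?T (concat (replicate n ?abc)) s" for n
  have g_Suc: "g (Suc n) = reflection \<Gamma> c (reflection \<Gamma> b (reflection \<Gamma> a (g n)))" for n
  proof -
    have "concat (replicate (Suc n) ?abc) = concat (replicate n ?abc) @ ?abc"
      by (induction n) simp_all
    then show ?thesis unfolding g_def by simp
  qed
  have step: "0 \<le> g (Suc n) a \<and> g n a < g (Suc n) a \<and> g (Suc n) a < g (Suc n) b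
      \<and> g (Suc n) b < g (Suc n) c"
    if "0 \<le> g n a" "g n a < g n b" "g n b < g n c" for n
  proof -
    let ?v1 = "reflection \<Gamma> a (g n)"
    let ?v2 = "reflection \<Gamma> b ?v1"
    have 1: "0 \<le> ?v1 b" "?v1 b < ?v1 c" "?v1 c < ?v1 a" "?v1 b = g n b"
      by (rule reflection_grows[OF V E(1,3) m(1,3) that HOL.refl])+
    have V': "verts \<Gamma> = {b, c, a}" "verts \<Gamma> = {c, a, b}" using V by auto
    have ne: "b \<noteq> a" "c \<noteq> a" "c \<noteq> b" using V by simp_all
    have E': "{b, a} \<in> edges \<Gamma>" "{c, a} \<in> edges \<Gamma>" "{c, b} \<in> edges \<Gamma>"
      using E by (simp_all add: insert_commute)
    have m': "label \<Gamma> {b, a} \<ge> 3" "label \<Gamma> {c, a} \<ge> 3" "label \<Gamma> {c, b} \<ge> 3"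
      using m by (simp_all add: insert_commute)
    note 2 = reflection_grows[OF V'(1) V(3) ne(2,1) E(2) E'(1) m(2) m'(1) 1(1-3) HOL.refl]
    note 3 = reflection_grows[OF V'(2) ne(2) V(2) ne(3) E'(2,3) m'(2,3) 2(1-3) g_Suc]
    show ?thesis using 1 2 3 that by simp
  qed
  have inv: "0 \<le> g n a \<and> g n a < g n b \<and> g n b < g n c" for n
  proof (induction n)
    case 0
    show ?case using V by (simp add: g_def s_def)
  next
    case (Suc n)
    then show ?case using step[of n] by auto
  qed
  have "g n a < g (Suc n) a" for n
    using step[of n] inv[of n] by simp
  then have mono: "strict_mono (\<lambda>n. g n a)"
    unfolding strict_mono_Suc_iff by blast
  have "inj g"
  proof (rule injI)
    fix i j assume "g i = g j"
    then have "g i a = g j a" by simp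
    then show "i = j" using strict_mono_eq[OF mono] by simp
  qed
  moreover have "range g \<subseteq> (\<lambda>w. fold ?T w s) ` words_over (verts \<Gamma>)"
  proof
    fix v assume "v \<in> range g"
    then obtain n where "v = g n" by blast
    moreover have "concat (replicate n ?abc) \<in> words_over (verts \<Gamma>)"
      by (induction n) (simp_all add: V)
    ultimately show "v \<in> (\<lambda>w. fold ?T w s) ` words_over (verts \<Gamma>)"
      unfolding g_def by blast
  qed
  ultimately have "infinite ((\<lambda>w. fold ?T w s) ` words_over (verts \<Gamma>))"
    by (meson infinite_super range_inj_infinite)
  from not_spherical_if_infinite_orbit[OF \<Gamma> this] show ?thesis .
qed

lemma not_type_FC_triangle:
  assumes \<Gamma>: "defining_graph \<Gamma>"
    and V: "a \<noteq> b" "b \<noteq> c" "a \<noteq> c"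
    and m: "coeff \<Gamma> a b \<notin> {2, \<infinity>}" "coeff \<Gamma> b c \<notin> {2, \<infinity>}" "coeff \<Gamma> a c \<notin> {2, \<infinity>}"
  shows "\<not> type_FC \<Gamma>"
proof
  assume FC: "type_FC \<Gamma>"
  let ?U = "{a, b, c}"
  let ?\<Delta> = "full_subgraph \<Gamma> ?U"
  have *: "{x, y} \<in> edges \<Gamma> \<and> label \<Gamma> {x, y} \<ge> 3" if "coeff \<Gamma> x y \<notin> {2, \<infinity>}" for x y
  proof -
    have e: "{x, y} \<in> edges \<Gamma>"
      using that by (auto simp: coeff_def split: if_splits)
    moreover have "label \<Gamma> {x, y} \<noteq> 2"
      using that e by (auto simp: coeff_def numeral_eq_enat)
    moreover have "label \<Gamma> {x, y} \<ge> 2"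
      using \<Gamma> e by (auto simp: defining_graph_def PiE_iff)
    ultimately show ?thesis by simp
  qed
  note E = *[OF m(1)] *[OF m(2)] *[OF m(3)]
  have U: "?U \<subseteq> verts \<Gamma>"
    using \<Gamma> E unfolding defining_graph_def by blast
  have "complete_graph ?\<Delta>"
    using E by (auto simp: complete_graph_def full_subgraph_def Let_def insert_commute)
  then have "spherical ?\<Delta>"
    using FC U unfolding type_FC_def by blast
  moreover have "defining_graph ?\<Delta>"
    using \<Gamma> by (auto simp: defining_graph_def full_subgraph_def Let_def PiE_iff)
  ultimately show False
    using not_spherical_triangle[of ?\<Delta> a b c] V E by (auto simp: full_subgraph_def Let_def)
qed


section \<open>The edge coefficients of a random graph are independent and uniform\<close>

text \<open>The function \<open>coeff\<close> with the unordered pair as its argument, so that independent coefficients are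
  indexed by a set.\<close>

definition edge_coeff :: "'a labelled_graph \<Rightarrow> 'a set \<Rightarrow> enat" where
  "edge_coeff \<Gamma> e = (if e \<in> edges \<Gamma> then enat (label \<Gamma> e) else \<infinity>)"

definition vertex_pairs :: "nat \<Rightarrow> nat set set" where
  "vertex_pairs N = {e. e \<subseteq> {..<N} \<and> card e = 2}"

definition coeff_values :: "nat \<Rightarrow> enat set" where
  "coeff_values M = {\<infinity>} \<union> enat ` {2..M}"

definition graph_prob :: "nat \<Rightarrow> nat \<Rightarrow> nat labelled_graph set \<Rightarrow> real" where
  "graph_prob N M F = real (card (F \<inter> graphs_upto N M)) / real (card (graphs_upto N M))"

lemma coeff_eq_edge_coeff: "coeff \<Gamma> a b = edge_coeff \<Gamma> {a, b}"
  by (simp add: coeff_def edge_coeff_def)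

lemma card_coeff_values: "M \<ge> 1 \<Longrightarrow> card (coeff_values M) = M"
  unfolding coeff_values_def by (subst card_Un_disjoint) (auto simp: card_image inj_on_def)

lemma finite_vertex_pairs: "finite (vertex_pairs N)"
  by (rule finite_subset[of _ "Pow {..<N}"]) (auto simp: vertex_pairs_def)

lemma vertex_pair_iff: "{a, b} \<in> vertex_pairs N \<longleftrightarrow> a < N \<and> b < N \<and> a \<noteq> b"
  by (cases "a = b") (auto simp: vertex_pairs_def)

lemma vertex_pairE:
  assumes "e \<in> vertex_pairs N"
  obtains a b where "e = {a, b}" "a < N" "b < N" "a \<noteq> b"
  using assms unfolding vertex_pairs_def card_2_iff by auto

text \<open>Injectivity uses that labels are \<open>undefined\<close> outside the edge set.\<close>

lemma bij_betw_edge_coeff: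
  "bij_betw (\<lambda>\<Gamma>. restrict (edge_coeff \<Gamma>) (vertex_pairs N))
     (graphs_upto N M) (vertex_pairs N \<rightarrow>\<^sub>E coeff_values M)"
proof (rule bij_betwI')
  fix \<Gamma> \<Delta> assume G: "\<Gamma> \<in> graphs_upto N M" "\<Delta> \<in> graphs_upto N M"
  have sub: "edges \<Gamma> \<subseteq> vertex_pairs N" "edges \<Delta> \<subseteq> vertex_pairs N"
    using G unfolding graphs_upto_def defining_graph_def vertex_pairs_def by force+
  show "(restrict (edge_coeff \<Gamma>) (vertex_pairs N) = restrict (edge_coeff \<Delta>) (vertex_pairs N)) = (\<Gamma> = \<Delta>)"
  proof
    assume "restrict (edge_coeff \<Gamma>) (vertex_pairs N) = restrict (edge_coeff \<Delta>) (vertex_pairs N)"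
    then have eq: "edge_coeff \<Gamma> e = edge_coeff \<Delta> e" if "e \<in> vertex_pairs N" for e
      using that by (metis restrict_apply')
    have E: "edges \<Gamma> = edges \<Delta>"
    proof (rule Set.set_eqI)
      fix e
      show "e \<in> edges \<Gamma> \<longleftrightarrow> e \<in> edges \<Delta>"
        using eq[of e] sub by (cases "e \<in> vertex_pairs N") (auto simp: edge_coeff_def split: if_splits)
    qed
    have "label \<Gamma> e = label \<Delta> e" for e
    proof (cases "e \<in> edges \<Gamma>")
      case True
      then show ?thesis using eq[of e] sub E by (auto simp: edge_coeff_def)
    next
      case False
      then show ?thesis
        using G E by (auto simp: graphs_upto_def defining_graph_def PiE_iff extensional_def)
    qed
    then show "\<Gamma> = \<Delta>"
      using G E by (intro labelled_graph.equality) (auto simp: graphs_upto_def)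
  qed simp
next
  fix \<Gamma> assume G: "\<Gamma> \<in> graphs_upto N M"
  have "edge_coeff \<Gamma> e \<in> coeff_values M" if "e \<in> vertex_pairs N" for e
    using that
  proof (rule vertex_pairE)
    fix a b assume "e = {a, b}" "a < N" "b < N" "a \<noteq> b"
    then show ?thesis
      using G by (simp add: graphs_upto_def coeff_values_def coeff_eq_edge_coeff)
  qed
  then show "restrict (edge_coeff \<Gamma>) (vertex_pairs N) \<in> vertex_pairs N \<rightarrow>\<^sub>E coeff_values M"
    by simp
next
  fix g assume g: "g \<in> vertex_pairs N \<rightarrow>\<^sub>E coeff_values M"
  define E where "E = {e \<in> vertex_pairs N. g e \<noteq> \<infinity>}"
  define \<Gamma> where "\<Gamma> = \<lparr>verts = {..<N}, edges = E, label = restrict (\<lambda>e. the_enat (g e)) E\<rparr>"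
  have ec: "edge_coeff \<Gamma> e = g e" if "e \<in> vertex_pairs N" for e
    using that by (auto simp: edge_coeff_def \<Gamma>_def E_def)
  have "the_enat (g e) \<ge> 2" if "e \<in> E" for e
    using that g by (auto simp: E_def coeff_values_def dest!: PiE_mem)
  then have "defining_graph \<Gamma>"
    by (auto simp: defining_graph_def \<Gamma>_def) (auto simp: E_def vertex_pairs_def)
  moreover have "coeff \<Gamma> a b \<in> {\<infinity>} \<union> enat ` {2..M}" if "a < N" "b < N" "a \<noteq> b" for a b
    using ec[of "{a, b}"] that g unfolding coeff_eq_edge_coeff coeff_values_def[symmetric]
    by (auto simp: vertex_pair_iff dest: PiE_mem)
  ultimately have "\<Gamma> \<in> graphs_upto N M"
    by (simp add: graphs_upto_def \<Gamma>_def)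
  moreover have "g = restrict (edge_coeff \<Gamma>) (vertex_pairs N)"
    using g ec by (auto simp: fun_eq_iff PiE_iff extensional_def)
  ultimately show "\<exists>\<Gamma>\<in>graphs_upto N M. g = restrict (edge_coeff \<Gamma>) (vertex_pairs N)"
    by blast
qed

lemma card_graphs_upto:
  assumes "M \<ge> 1"
  shows "card (graphs_upto N M) = M ^ card (vertex_pairs N)"
  using bij_betw_same_card[OF bij_betw_edge_coeff[of N M]] assms
  by (simp add: card_PiE finite_vertex_pairs card_coeff_values)

lemma finite_graphs_upto: "finite (graphs_upto N M)"
proof -
  have "finite (vertex_pairs N \<rightarrow>\<^sub>E coeff_values M)"
    by (intro finite_PiE finite_vertex_pairs) (simp add: coeff_values_def)
  then show ?thesis
    using bij_betw_finite[OF bij_betw_edge_coeff[of N M]] by blast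
qed

text \<open>Under \<open>bij_betw_edge_coeff\<close> the event becomes a product set again, with the factor \<open>B\<close> instead of all
  values at the pairs in \<open>J\<close>.\<close>

lemma graph_prob_edges:
  assumes "M \<ge> 1" and J: "J \<subseteq> vertex_pairs N" and B: "B \<subseteq> coeff_values M"
  shows "graph_prob N M {\<Gamma>. \<forall>e\<in>J. edge_coeff \<Gamma> e \<in> B} = (real (card B) / real M) ^ card J"
proof -
  let ?I = "vertex_pairs N" and ?K = "coeff_values M"
  let ?\<phi> = "\<lambda>\<Gamma>. restrict (edge_coeff \<Gamma>) ?I"
  let ?F = "{\<Gamma>. \<forall>e\<in>J. edge_coeff \<Gamma> e \<in> B}"
  have bij: "bij_betw ?\<phi> (graphs_upto N M) (?I \<rightarrow>\<^sub>E ?K)"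
    by (rule bij_betw_edge_coeff)
  have "?\<phi> ` (?F \<inter> graphs_upto N M) = PiE ?I (\<lambda>e. if e \<in> J then B else ?K)"
  proof (intro equalityI subsetI)
    fix g assume "g \<in> ?\<phi> ` (?F \<inter> graphs_upto N M)"
    then obtain \<Gamma> where \<Gamma>: "\<Gamma> \<in> ?F" "\<Gamma> \<in> graphs_upto N M" "g = ?\<phi> \<Gamma>" by blast
    then have "g \<in> ?I \<rightarrow>\<^sub>E ?K" using bij_betw_apply[OF bij] by blast
    with \<Gamma> J show "g \<in> PiE ?I (\<lambda>e. if e \<in> J then B else ?K)"
      by (auto simp: PiE_iff)
  next
    fix g assume g: "g \<in> PiE ?I (\<lambda>e. if e \<in> J then B else ?K)"
    then have "g \<in> ?I \<rightarrow>\<^sub>E ?K" using B by (auto simp: PiE_iff split: if_splits)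
    then obtain \<Gamma> where \<Gamma>: "\<Gamma> \<in> graphs_upto N M" "g = ?\<phi> \<Gamma>"
      using bij unfolding bij_betw_def by blast
    have "edge_coeff \<Gamma> e \<in> B" if "e \<in> J" for e
      using PiE_mem[OF g, of e] that J \<Gamma> by auto
    with \<Gamma> show "g \<in> ?\<phi> ` (?F \<inter> graphs_upto N M)" by blast
  qed
  then have "card (PiE ?I (\<lambda>e. if e \<in> J then B else ?K)) = card (?\<phi> ` (?F \<inter> graphs_upto N M))"
    by (rule arg_cong[OF HOL.sym])
  also have "\<dots> = card (?F \<inter> graphs_upto N M)"
  proof (rule card_image)
    show "inj_on ?\<phi> (?F \<inter> graphs_upto N M)"
      by (rule inj_on_subset[OF bij_betw_imp_inj_on[OF bij]]) simp
  qed
  finally have "card (?F \<inter> graphs_upto N M) = card (PiE ?I (\<lambda>e. if e \<in> J then B else ?K))"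
    by (rule HOL.sym)
  also have "\<dots> = (\<Prod>e\<in>?I. if e \<in> J then card B else M)"
    using assms by (auto simp: card_PiE finite_vertex_pairs card_coeff_values intro!: prod.cong)
  also have "\<dots> = card B ^ card J * M ^ card (?I - J)"
    using J by (simp add: prod.If_cases finite_vertex_pairs Int_absorb1 Diff_eq)
  also have "card (?I - J) = card ?I - card J"
    using J finite_vertex_pairs by (meson card_Diff_subset finite_subset)
  finally have *: "card (?F \<inter> graphs_upto N M) = card B ^ card J * M ^ (card ?I - card J)" .
  have "card J \<le> card ?I"
    using J finite_vertex_pairs by (rule card_mono[rotated])
  then have "real M ^ card ?I = real M ^ card J * real M ^ (card ?I - card J)"
    by (simp flip: power_add)
  then show ?thesis
    using assms(1) by (simp add: graph_prob_def * card_graphs_upto power_divide)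
qed

lemma graph_prob_nonneg: "graph_prob N M F \<ge> 0"
  by (simp add: graph_prob_def)

lemma graph_prob_mono:
  assumes "\<And>\<Gamma>. \<Gamma> \<in> F \<Longrightarrow> \<Gamma> \<in> graphs_upto N M \<Longrightarrow> \<Gamma> \<in> F'"
  shows "graph_prob N M F \<le> graph_prob N M F'"
proof -
  have "card (F \<inter> graphs_upto N M) \<le> card (F' \<inter> graphs_upto N M)"
    using assms by (intro card_mono) (auto simp: finite_graphs_upto)
  then show ?thesis by (simp add: graph_prob_def divide_right_mono)
qed

lemma graph_prob_UN_le:
  assumes "finite I"
  shows "graph_prob N M (\<Union>i\<in>I. F i) \<le> (\<Sum>i\<in>I. graph_prob N M (F i))"
proof -
  have "card ((\<Union>i\<in>I. F i) \<inter> graphs_upto N M) = card (\<Union>i\<in>I. F i \<inter> graphs_upto N M)"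
    by (rule arg_cong[of _ _ card]) blast
  also have "\<dots> \<le> (\<Sum>i\<in>I. card (F i \<inter> graphs_upto N M))"
    using assms by (rule card_UN_le)
  finally have "real (card ((\<Union>i\<in>I. F i) \<inter> graphs_upto N M)) \<le> (\<Sum>i\<in>I. real (card (F i \<inter> graphs_upto N M)))"
    by (metis of_nat_le_iff of_nat_sum)
  then show ?thesis
    by (simp add: graph_prob_def divide_right_mono flip: sum_divide_distrib)
qed

lemma graph_prob_compl:
  assumes "M \<ge> 1"
  shows "graph_prob N M (- F) = 1 - graph_prob N M F"
proof -
  have "card (graphs_upto N M) = card (F \<inter> graphs_upto N M) + card (- F \<inter> graphs_upto N M)"
    by (subst card_Un_disjoint[symmetric]) (auto simp: finite_graphs_upto intro!: arg_cong[of _ _ card])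
  moreover have "card (graphs_upto N M) \<noteq> 0"
    using assms by (simp add: card_graphs_upto)
  ultimately show ?thesis
    by (simp add: graph_prob_def field_simps flip: of_nat_add)
qed


section \<open>Cuts of a random graph\<close>

definition monochromatic_cut :: "enat \<Rightarrow> 'a labelled_graph \<Rightarrow> 'a set \<Rightarrow> bool" where
  "monochromatic_cut k \<Gamma> S \<longleftrightarrow> (\<forall>s\<in>S. \<forall>t\<in>verts \<Gamma> - S. coeff \<Gamma> s t = k)"

text \<open>It is enough that \<open>N - 1\<close> of the crossing pairs have coefficient \<open>k\<close>. Fix \<open>s\<close> in \<open>S\<close> and \<open>t\<close>
  outside it, and join \<open>t\<close> to all of \<open>S\<close> and \<open>s\<close> to all of the complement. This double star is a
  spanning tree, and every edge of it crosses the cut.\<close>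

lemma graph_prob_cut:
  assumes "M \<ge> 1" "k \<in> coeff_values M" "S \<subset> {..<N}" "S \<noteq> {}"
  shows "graph_prob N M {\<Gamma>. monochromatic_cut k \<Gamma> S} \<le> (1 / real M) ^ (N - 1)"
proof -
  obtain s t where st: "s \<in> S" "t < N" "t \<notin> S" using assms by auto
  then have s: "s < N" using assms by auto
  \<comment> \<open>Each vertex other than \<open>s\<close> gives one edge; \<open>s\<close> is left out because \<open>h s = h t\<close>.\<close>
  define h where "h x = {x, if x \<in> S then t else s}" for x
  let ?J = "h ` ({..<N} - {s})"
  have inj: "inj_on h ({..<N} - {s})"
    using st by (auto simp: inj_on_def h_def doubleton_eq_iff split: if_splits)
  have "card ?J = N - 1"
    using card_image[OF inj] s by simp
  moreover have "?J \<subseteq> vertex_pairs N"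
    using st s by (auto simp: h_def vertex_pair_iff split: if_splits)
  then have "graph_prob N M {\<Gamma>. \<forall>e\<in>?J. edge_coeff \<Gamma> e \<in> {k}} = (1 / real M) ^ card ?J"
    using graph_prob_edges[of M ?J N "{k}"] assms by simp
  moreover have "graph_prob N M {\<Gamma>. monochromatic_cut k \<Gamma> S}
      \<le> graph_prob N M {\<Gamma>. \<forall>e\<in>?J. edge_coeff \<Gamma> e \<in> {k}}"
    using st s by (intro graph_prob_mono)
      (auto simp: monochromatic_cut_def graphs_upto_def coeff_eq_edge_coeff h_def insert_commute)
  ultimately show ?thesis by simp
qed

text \<open>Union bound over all \<open>S\<close>. The bound \<open>M \<ge> 4\<close> makes the decay \<open>4\<^sup>-\<^sup>(\<^sup>N\<^sup>-\<^sup>1\<^sup>)\<close> beat the number \<open>2\<^sup>N\<close> of sets.\<close>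

lemma graph_prob_some_cut:
  assumes "M \<ge> 4" "k \<in> coeff_values M" "N \<ge> 1"
  shows "graph_prob N M {\<Gamma>. \<exists>S. S \<subset> {..<N} \<and> S \<noteq> {} \<and> monochromatic_cut k \<Gamma> S} \<le> 2 * (1 / 2) ^ (N - 1)"
proof -
  let ?C = "{S. S \<subset> {..<N} \<and> S \<noteq> {}}"
  have C: "?C \<subseteq> Pow {..<N}" by auto
  then have fin: "finite ?C" by (rule finite_subset) simp
  have "card ?C \<le> 2 ^ N"
    using card_mono[OF _ C] by (simp add: card_Pow)
  then have card: "real (card ?C) \<le> 2 ^ N"
    by (metis of_nat_le_iff of_nat_numeral of_nat_power)
  have "{\<Gamma>. \<exists>S. S \<subset> {..<N} \<and> S \<noteq> {} \<and> monochromatic_cut k \<Gamma> S}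
      = (\<Union>S\<in>?C. {\<Gamma>. monochromatic_cut k \<Gamma> S})" by auto
  then have "graph_prob N M {\<Gamma>. \<exists>S. S \<subset> {..<N} \<and> S \<noteq> {} \<and> monochromatic_cut k \<Gamma> S}
      \<le> (\<Sum>S\<in>?C. graph_prob N M {\<Gamma>. monochromatic_cut k \<Gamma> S})"
    using graph_prob_UN_le[OF fin] by simp
  also have "\<dots> \<le> (\<Sum>S\<in>?C. (1 / real M) ^ (N - 1))"
    using assms by (intro sum_mono graph_prob_cut) auto
  also have "\<dots> \<le> (\<Sum>S\<in>?C. (1 / 4) ^ (N - 1))"
    using assms by (intro sum_mono power_mono) (auto simp: field_simps)
  also have "\<dots> = real (card ?C) * (1 / 4) ^ (N - 1)" by simp
  also have "\<dots> \<le> 2 ^ N * (1 / 4) ^ (N - 1)"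
    using card by (intro mult_right_mono) auto
  also have "\<dots> = 2 * (2 ^ (N - 1) * (1 / 4) ^ (N - 1))"
    using assms(3) by (cases N) auto
  also have "\<dots> = 2 * (1 / 2) ^ (N - 1)"
    by (simp flip: power_mult_distrib)
  finally show ?thesis .
qed

lemma uniformly_large_if_cut:
  assumes cut: "\<And>\<Gamma>. defining_graph \<Gamma> \<Longrightarrow> \<not> P \<Gamma> \<Longrightarrow>
      \<exists>S. S \<subset> verts \<Gamma> \<and> S \<noteq> {} \<and> monochromatic_cut k \<Gamma> S"
    and k: "k \<in> {2, \<infinity>}"
  shows "uniformly_large {\<Gamma>. defining_graph \<Gamma> \<and> P \<Gamma>}"
  unfolding uniformly_large_def
proof (intro allI impI, elim conjE)
  fix f :: "nat \<Rightarrow> nat"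
  assume "filterlim f at_top sequentially"
  then have ev: "eventually (\<lambda>N. f N \<ge> 4) sequentially"
    by (simp add: filterlim_at_top)
  let ?F = "{\<Gamma>. defining_graph \<Gamma> \<and> P \<Gamma>}"
  have bound: "graph_prob N (f N) (- ?F) \<le> 2 * (1 / 2) ^ (N - 1)" if "f N \<ge> 4" "N \<ge> 1" for N
  proof -
    have k': "k \<in> coeff_values (f N)"
      using k that by (auto simp: coeff_values_def numeral_eq_enat)
    have "graph_prob N (f N) (- ?F) \<le>
        graph_prob N (f N) {\<Gamma>. \<exists>S. S \<subset> {..<N} \<and> S \<noteq> {} \<and> monochromatic_cut k \<Gamma> S}"
    proof (rule graph_prob_mono)
      fix \<Gamma> assume "\<Gamma> \<in> - ?F" "\<Gamma> \<in> graphs_upto N (f N)"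
      then have "defining_graph \<Gamma>" "\<not> P \<Gamma>" "verts \<Gamma> = {..<N}"
        by (simp_all add: graphs_upto_def)
      then show "\<Gamma> \<in> {\<Gamma>. \<exists>S. S \<subset> {..<N} \<and> S \<noteq> {} \<and> monochromatic_cut k \<Gamma> S}"
        using cut[of \<Gamma>] by simp
    qed
    also have "graph_prob N (f N) {\<Gamma>. \<exists>S. S \<subset> {..<N} \<and> S \<noteq> {} \<and> monochromatic_cut k \<Gamma> S}
        \<le> 2 * (1 / 2) ^ (N - 1)"
      using that k' by (intro graph_prob_some_cut) simp_all
    finally show ?thesis .
  qed
  have ub: "eventually (\<lambda>N. graph_prob N (f N) (- ?F) \<le> 2 * (1 / 2) ^ (N - 1)) sequentially"
    using ev eventually_ge_at_top[of 1] by eventually_elim (rule bound)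
  have "(\<lambda>N. 2 * (1 / 2 :: real) ^ N) \<longlonglongrightarrow> 2 * 0"
    by (intro tendsto_mult tendsto_const LIMSEQ_power_zero) simp
  then have lim: "(\<lambda>N. 2 * (1 / 2 :: real) ^ (N - 1)) \<longlonglongrightarrow> 0"
    using filterlim_sequentially_Suc[of "\<lambda>N. 2 * (1 / 2 :: real) ^ (N - 1)" "nhds 0"] by simp
  have "(\<lambda>N. graph_prob N (f N) (- ?F)) \<longlonglongrightarrow> 0"
    by (rule tendsto_sandwich[OF _ ub tendsto_const lim]) (simp add: graph_prob_nonneg)
  then have "(\<lambda>N. 1 - graph_prob N (f N) (- ?F)) \<longlonglongrightarrow> 1"
    using tendsto_diff[OF tendsto_const[of 1]] by fastforce
  moreover have "eventually (\<lambda>N. 1 - graph_prob N (f N) (- ?F) = graph_prob N (f N) ?F) sequentially"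
    using ev by eventually_elim (simp add: graph_prob_compl)
  ultimately have "(\<lambda>N. graph_prob N (f N) ?F) \<longlonglongrightarrow> 1"
    by (rule Lim_transform_eventually)
  then show "has_asymptotic_prob f ?F 1"
    by (simp add: has_asymptotic_prob_def graph_prob_def)
qed

lemma reducible_cut:
  assumes "\<not> irreducible_graph \<Gamma>"
  shows "\<exists>S. S \<subset> verts \<Gamma> \<and> S \<noteq> {} \<and> monochromatic_cut 2 \<Gamma> S"
  using assms unfolding irreducible_graph_def reducible_graph_def monochromatic_cut_def by blast

text \<open>Cut off the connected component of a vertex \<open>a\<close> from which some \<open>b\<close> cannot be reached.\<close>

lemma disconnected_cut:
  assumes "\<not> connected_graph \<Gamma>"
  shows "\<exists>S. S \<subset> verts \<Gamma> \<and> S \<noteq> {} \<and> monochromatic_cut \<infinity> \<Gamma> S"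
proof -
  let ?R = "{(x, y). {x, y} \<in> edges \<Gamma>}\<^sup>*"
  obtain a b where ab: "a \<in> verts \<Gamma>" "b \<in> verts \<Gamma>" "(a, b) \<notin> ?R"
    using assms by (auto simp: connected_graph_def)
  let ?S = "{x \<in> verts \<Gamma>. (a, x) \<in> ?R}"
  have "coeff \<Gamma> s t = \<infinity>" if "s \<in> ?S" "t \<in> verts \<Gamma> - ?S" for s t
  proof (rule ccontr)
    assume "coeff \<Gamma> s t \<noteq> \<infinity>"
    then have "(s, t) \<in> {(x, y). {x, y} \<in> edges \<Gamma>}"
      by (auto simp: coeff_def split: if_splits)
    with that show False by (auto intro: rtrancl_into_rtrancl)
  qed
  then have "monochromatic_cut \<infinity> \<Gamma> ?S" by (simp add: monochromatic_cut_def)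
  moreover have "?S \<subset> verts \<Gamma>" "?S \<noteq> {}" using ab by auto
  ultimately show ?thesis by blast
qed


section \<open>A fixed triangle of a random graph\<close>

text \<open>Each of the three pairs has a coefficient in \<open>{2, \<infinity>}\<close> with probability \<open>2 / f N\<close>, so the property can hold
  with probability at most \<open>6 / f N\<close>.\<close>

lemma uniformly_small_if_triangle:
  assumes tri: "\<And>\<Gamma>. defining_graph \<Gamma> \<Longrightarrow> {0, 1, 2} \<subseteq> verts \<Gamma> \<Longrightarrow>
      coeff \<Gamma> 0 1 \<notin> {2, \<infinity>} \<Longrightarrow> coeff \<Gamma> 1 2 \<notin> {2, \<infinity>} \<Longrightarrow> coeff \<Gamma> 0 2 \<notin> {2, \<infinity>} \<Longrightarrow> \<not> P \<Gamma>"
  shows "uniformly_small {\<Gamma>. defining_graph \<Gamma> \<and> P \<Gamma>}"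
  unfolding uniformly_small_def
proof (intro allI impI, elim conjE)
  fix f :: "nat \<Rightarrow> nat"
  assume f: "filterlim f at_top sequentially"
  then have ev: "eventually (\<lambda>N. f N \<ge> 2) sequentially"
    by (simp add: filterlim_at_top)
  let ?F = "{\<Gamma>. defining_graph \<Gamma> \<and> P \<Gamma>}"
  let ?T = "{{0, 1}, {1, 2}, {0, 2}} :: nat set set"
  have bound: "graph_prob N (f N) ?F \<le> 6 / real (f N)" if "f N \<ge> 2" "N \<ge> 3" for N
  proof -
    have sub: "{2, \<infinity>} \<subseteq> coeff_values (f N)"
      using that by (auto simp: coeff_values_def numeral_eq_enat)
    have "graph_prob N (f N) ?F \<le> graph_prob N (f N) (\<Union>e\<in>?T. {\<Gamma>. edge_coeff \<Gamma> e \<in> {2, \<infinity>}})"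
      using tri that unfolding coeff_eq_edge_coeff
      by (intro graph_prob_mono) (fastforce simp: graphs_upto_def)
    also have "\<dots> \<le> (\<Sum>e\<in>?T. graph_prob N (f N) {\<Gamma>. edge_coeff \<Gamma> e \<in> {2, \<infinity>}})"
      by (rule graph_prob_UN_le) simp
    also have "\<dots> = (\<Sum>e\<in>?T. 2 / real (f N))"
    proof (rule sum.cong[OF HOL.refl])
      fix e assume "e \<in> ?T"
      then have "{e} \<subseteq> vertex_pairs N"
        using that by (auto simp: vertex_pair_iff)
      then show "graph_prob N (f N) {\<Gamma>. edge_coeff \<Gamma> e \<in> {2, \<infinity>}} = 2 / real (f N)"
        using graph_prob_edges[of "f N" "{e}" N "{2, \<infinity>}"] sub that by simp
    qed
    also have "\<dots> = 6 / real (f N)"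
      by (simp add: doubleton_eq_iff)
    finally show ?thesis .
  qed
  have ub: "eventually (\<lambda>N. graph_prob N (f N) ?F \<le> 6 / real (f N)) sequentially"
    using ev eventually_ge_at_top[of 3] by eventually_elim (rule bound)
  have lim: "(\<lambda>N. 6 / real (f N)) \<longlonglongrightarrow> 0"
    by (intro real_tendsto_divide_at_top[OF tendsto_const]
        filterlim_compose[OF filterlim_real_sequentially f])
  have "(\<lambda>N. graph_prob N (f N) ?F) \<longlonglongrightarrow> 0"
    by (rule tendsto_sandwich[OF _ ub tendsto_const lim]) (simp add: graph_prob_nonneg)
  then show "has_asymptotic_prob f ?F 0"
    by (simp add: has_asymptotic_prob_def graph_prob_def)
qed

theorem theorem1p1:
  "uniformly_large {\<Gamma>. defining_graph \<Gamma> \<and> irreducible_graph \<Gamma>} \<and>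
   uniformly_large {\<Gamma>. defining_graph \<Gamma> \<and> connected_graph \<Gamma>} \<and>
   uniformly_small {\<Gamma>. defining_graph \<Gamma> \<and> type_FC \<Gamma>} \<and>
   uniformly_small {\<Gamma>. defining_graph \<Gamma> \<and> raag \<Gamma>} \<and>
   uniformly_small {\<Gamma>. defining_graph \<Gamma> \<and> triangle_free_graph \<Gamma>}"
proof (intro conjI)
  show "uniformly_large {\<Gamma>. defining_graph \<Gamma> \<and> irreducible_graph \<Gamma>}"
    by (rule uniformly_large_if_cut[where k = 2]) (use reducible_cut in auto)
  show "uniformly_large {\<Gamma>. defining_graph \<Gamma> \<and> connected_graph \<Gamma>}"
    by (rule uniformly_large_if_cut[where k = \<infinity>]) (use disconnected_cut in auto)
  show "uniformly_small {\<Gamma>. defining_graph \<Gamma> \<and> type_FC \<Gamma>}"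
    by (rule uniformly_small_if_triangle[where P = type_FC])
      (use not_type_FC_triangle[of _ "0::nat" 1 2] in simp)
  show "uniformly_small {\<Gamma>. defining_graph \<Gamma> \<and> raag \<Gamma>}"
    by (rule uniformly_small_if_triangle[where P = raag]) (force simp: raag_def)
  show "uniformly_small {\<Gamma>. defining_graph \<Gamma> \<and> triangle_free_graph \<Gamma>}"
  proof (rule uniformly_small_if_triangle[where P = triangle_free_graph])
    fix \<Gamma> :: "nat labelled_graph"
    assume "coeff \<Gamma> 0 1 \<notin> {2, \<infinity>}" "coeff \<Gamma> 1 2 \<notin> {2, \<infinity>}" "coeff \<Gamma> 0 2 \<notin> {2, \<infinity>}"
    then have "{0, 1} \<in> edges \<Gamma>" "{1, 2} \<in> edges \<Gamma>" "{0, 2} \<in> edges \<Gamma>"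
      by (auto simp: coeff_def split: if_splits)
    then show "\<not> triangle_free_graph \<Gamma>"
      unfolding triangle_free_graph_def not_not
      by (intro exI[of _ 0] exI[of _ 1] exI[of _ 2]) simp
  qed
qed

end
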